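(* Closed subspaces of quasisober spaces (respectively cut spaces, weakly sober spaces) are not always quasisober (respectively cut spaces, weakly sober). That is: (i) there exist a quasisober space $X$ and a closed subset $C\subseteq X$ such that the subspace $C$ is not quasisober; (ii) there exist a cut space $X$ and a closed subset $C\subseteq X$ such that the subspace $C$ is not a cut space; (iii) there exist a weakly sober space $X$ and a closed subset $C\subseteq X$ such that the subspace $C$ is not weakly sober.
   Context: For a topological space $X$, the specialization preorder is $x\le y$ iff $x\in\mathrm{cl}\{y\}$; all order-theoretic notions in $X$ refer to it (for a subspace, to the specialization preorder of the subspace, with bounds taken inside the subspace). For $A\subseteq X$, $A^{\uparrow}$ and $A^{\downarrow}$ denote the sets of all upper, respectively lower, bounds of $A$ in $X$, and $A^{\delta}=(A^{\uparrow})^{\downarrow}$ is the cut closure of $A$; $A$ is a cut if $A=A^{\delta}$. Directed sets and irreducible closed sets are nonempty. $X$ is a cut space if $\mathrm{cl}\,D=D^{\delta}$ for every directed subset $D$ of $X$. $X$ is weakly sober if it is $T_0$ and every irreducible closed subset $A$ of $X$ is a cut. $X$ is quasisober if it is $T_0$ and every irreducible closed subset of $X$ equals $D^{\delta}$ for some directed subset $D$ of $X$. *)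

theory Defs
  imports "HOL-Analysis.Abstract_Topological_Spaces"
begin

definition spec_le :: "'a topology \<Rightarrow> 'a \<Rightarrow> 'a \<Rightarrow> bool" where
  "spec_le X x y \<longleftrightarrow> x \<in> X closure_of {y}"

definition upper_bounds :: "'a topology \<Rightarrow> 'a set \<Rightarrow> 'a set" where
  "upper_bounds X A = {u \<in> topspace X. \<forall>a\<in>A. spec_le X a u}"

definition lower_bounds :: "'a topology \<Rightarrow> 'a set \<Rightarrow> 'a set" where
  "lower_bounds X A = {l \<in> topspace X. \<forall>a\<in>A. spec_le X l a}"

definition cut_closure :: "'a topology \<Rightarrow> 'a set \<Rightarrow> 'a set" where
  "cut_closure X A = lower_bounds X (upper_bounds X A)"

definition is_cut :: "'a topology \<Rightarrow> 'a set \<Rightarrow> bool" where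
  "is_cut X A \<longleftrightarrow> A = cut_closure X A"

definition directed_in :: "'a topology \<Rightarrow> 'a set \<Rightarrow> bool" where
  "directed_in X D \<longleftrightarrow> D \<subseteq> topspace X \<and> D \<noteq> {} \<and>
     (\<forall>x\<in>D. \<forall>y\<in>D. \<exists>z\<in>D. spec_le X x z \<and> spec_le X y z)"

definition irreducible_closedin :: "'a topology \<Rightarrow> 'a set \<Rightarrow> bool" where
  "irreducible_closedin X A \<longleftrightarrow> closedin X A \<and> A \<noteq> {} \<and>
     (\<forall>B C. closedin X B \<and> closedin X C \<and> A = B \<union> C \<longrightarrow> A = B \<or> A = C)"

definition cut_space :: "'a topology \<Rightarrow> bool" where
  "cut_space X \<longleftrightarrow> (\<forall>D. directed_in X D \<longrightarrow> X closure_of D = cut_closure X D)"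

definition weakly_sober_space :: "'a topology \<Rightarrow> bool" where
  "weakly_sober_space X \<longleftrightarrow> t0_space X \<and> (\<forall>A. irreducible_closedin X A \<longrightarrow> is_cut X A)"

definition quasisober_space :: "'a topology \<Rightarrow> bool" where
  "quasisober_space X \<longleftrightarrow> t0_space X \<and>
     (\<forall>A. irreducible_closedin X A \<longrightarrow> (\<exists>D. directed_in X D \<and> A = cut_closure X D))"

end

theory Submission
  imports Defs
begin

text \<open>Quasisober implies weakly sober, which implies cut space, so a single quasisober space with
  a closed subspace that is not a cut space suffices. Take a chain of type \<open>\<omega>\<close> below two incomparable
  points, with all lower sets closed. The chain is the cut of common lower bounds of the two points;
  after removal of one of them, the chain is still closed and directed, but its cut closure also
  contains the remaining point.\<close>

section \<open>Cut closures, and the implications between the three properties\<close>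

lemma closure_of_subset_cut_closure:
  assumes "A \<subseteq> topspace X"
  shows "X closure_of A \<subseteq> cut_closure X A"
proof
  fix x assume x: "x \<in> X closure_of A"
  \<comment> \<open>The cut closure is the part of the space common to the point closures of all
    upper bounds, and each of these closed sets contains \<open>A\<close>.\<close>
  have "x \<in> X closure_of {u}" if "u \<in> upper_bounds X A" for u
  proof -
    have "A \<subseteq> X closure_of {u}"
      using that by (auto simp: upper_bounds_def spec_le_def)
    then have "X closure_of A \<subseteq> X closure_of {u}"
      by (rule closure_of_minimal) simp
    then show ?thesis
      using x by (rule subsetD)
  qed
  moreover have "x \<in> topspace X"
    using x by (simp add: in_closure_of)
  ultimately show "x \<in> cut_closure X A"
    by (simp add: cut_closure_def lower_bounds_def spec_le_def)
qed

lemma cut_closure_mono: "A \<subseteq> B \<Longrightarrow> cut_closure X A \<subseteq> cut_closure X B"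
  by (auto simp: cut_closure_def lower_bounds_def upper_bounds_def)

text \<open>Upper and lower bounds form a Galois connection. This identity makes every cut closure a
  cut.\<close>

lemma upper_bounds_cut_closure:
  assumes "A \<subseteq> topspace X"
  shows "upper_bounds X (cut_closure X A) = upper_bounds X A"
proof
  have "A \<subseteq> cut_closure X A"
    using assms by (auto simp: cut_closure_def lower_bounds_def upper_bounds_def)
  then show "upper_bounds X (cut_closure X A) \<subseteq> upper_bounds X A"
    by (auto simp: upper_bounds_def)
  show "upper_bounds X A \<subseteq> upper_bounds X (cut_closure X A)"
    by (simp add: cut_closure_def lower_bounds_def) (auto simp: upper_bounds_def)
qed

text \<open>Closed sets are lower sets. If \<open>d\<close> misses \<open>B\<close> and
  \<open>e\<close> misses \<open>C\<close>, a common upper bound of them in \<open>D\<close> lies in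
  \<open>B\<close> or \<open>C\<close> and pulls \<open>d\<close> or \<open>e\<close> in with
  it.\<close>

lemma irreducible_closedin_closure_of_directed:
  assumes D: "directed_in X D"
  shows "irreducible_closedin X (X closure_of D)"
  unfolding irreducible_closedin_def
proof (intro conjI allI impI)
  have sub: "D \<subseteq> X closure_of D"
    using D by (simp add: directed_in_def closure_of_subset)
  then show "X closure_of D \<noteq> {}"
    using D by (auto simp: directed_in_def)
  fix B C assume BC: "closedin X B \<and> closedin X C \<and> X closure_of D = B \<union> C"
  have down: "x \<in> S" if "closedin X S" "z \<in> S" "spec_le X x z" for S x z
    using that closure_of_minimal[of "{z}" S X] by (auto simp: spec_le_def)
  have "D \<subseteq> B \<or> D \<subseteq> C"
  proof (rule ccontr)
    assume "\<not> ?thesis"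
    then obtain d e where "d \<in> D" "d \<notin> B" "e \<in> D" "e \<notin> C"
      by blast
    moreover from this obtain z where "z \<in> D" "spec_le X d z" "spec_le X e z"
      using D unfolding directed_in_def by blast
    ultimately show False
      using BC sub down by blast
  qed
  then have "X closure_of D \<subseteq> B \<or> X closure_of D \<subseteq> C"
    using BC closure_of_minimal[of D _ X] by metis
  then show "X closure_of D = B \<or> X closure_of D = C"
    using BC by auto
qed simp

lemma quasisober_imp_weakly_sober:
  assumes "quasisober_space X"
  shows "weakly_sober_space X"
  unfolding weakly_sober_space_def
proof (intro conjI allI impI)
  show "t0_space X"
    using assms by (simp add: quasisober_space_def)
  fix A assume "irreducible_closedin X A"
  then obtain D where D: "directed_in X D" "A = cut_closure X D"
    using assms by (auto simp: quasisober_space_def)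
  then have "upper_bounds X (cut_closure X D) = upper_bounds X D"
    by (simp add: upper_bounds_cut_closure directed_in_def)
  then have "cut_closure X (cut_closure X D) = cut_closure X D"
    by (simp add: cut_closure_def)
  then show "is_cut X A"
    using D(2) by (simp add: is_cut_def)
qed

text \<open>The closure of a directed set is irreducible, hence a cut containing \<open>D\<close>;
  monotonicity then puts the cut closure of \<open>D\<close> inside it.\<close>

lemma weakly_sober_imp_cut_space:
  assumes "weakly_sober_space X"
  shows "cut_space X"
  unfolding cut_space_def
proof (intro allI impI)
  fix D assume D: "directed_in X D"
  then have sub: "D \<subseteq> topspace X"
    by (simp add: directed_in_def)
  have "is_cut X (X closure_of D)"
    using assms irreducible_closedin_closure_of_directed[OF D]
    by (simp add: weakly_sober_space_def)
  then have "cut_closure X D \<subseteq> X closure_of D"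
    using cut_closure_mono[OF closure_of_subset[OF sub], of X] unfolding is_cut_def by blast
  then show "X closure_of D = cut_closure X D"
    using closure_of_subset_cut_closure[OF sub] by blast
qed

section \<open>The Alexandrov topology in which lower sets are closed\<close>

definition lower_topology :: "('a \<Rightarrow> 'a \<Rightarrow> bool) \<Rightarrow> 'a topology" where
  "lower_topology r = topology (\<lambda>U. \<forall>x\<in>U. \<forall>y. r x y \<longrightarrow> y \<in> U)"

text \<open>Sets closed upwards under any relation are stable under unions and intersections, so
  \<open>r\<close> need not be an order here.\<close>

lemma openin_lower_topology: "openin (lower_topology r) U \<longleftrightarrow> (\<forall>x\<in>U. \<forall>y. r x y \<longrightarrow> y \<in> U)"
proof -
  have "istopology (\<lambda>U. \<forall>x\<in>U. \<forall>y. r x y \<longrightarrow> y \<in> U)"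
    unfolding istopology_def by blast
  then show ?thesis
    by (simp add: lower_topology_def topology_inverse')
qed

lemma topspace_lower_topology [simp]: "topspace (lower_topology r) = UNIV"
  using openin_subset[of "lower_topology r" UNIV] by (auto simp: openin_lower_topology)

lemma closedin_lower_topology: "closedin (lower_topology r) S \<longleftrightarrow> (\<forall>y\<in>S. \<forall>x. r x y \<longrightarrow> x \<in> S)"
  by (auto simp: closedin_def openin_lower_topology)

lemma closure_of_lower_topology:
  assumes "reflp r" "transp r"
  shows "lower_topology r closure_of S = {x. \<exists>y\<in>S. r x y}"
proof (rule closure_of_unique)
  show "S \<subseteq> {x. \<exists>y\<in>S. r x y}"
    using assms(1) by (auto dest: reflpD)
  show "closedin (lower_topology r) {x. \<exists>y\<in>S. r x y}"
    using assms(2) by (auto simp: closedin_lower_topology dest: transpD)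
qed (simp add: closedin_lower_topology, blast)

lemma spec_le_lower_topology:
  assumes "reflp r" "transp r"
  shows "spec_le (lower_topology r) = r"
  by (intro ext) (simp add: spec_le_def closure_of_lower_topology assms)

lemma t0_space_lower_topology:
  assumes "reflp r" "transp r" "antisymp r"
  shows "t0_space (lower_topology r)"
  unfolding t0_space_def
proof (intro ballI impI)
  fix x y :: 'a assume "x \<noteq> y"
  then have "\<not> r x y \<or> \<not> r y x"
    using assms(3) by (auto dest: antisympD)
  \<comment> \<open>The set of points above \<open>w\<close> is open; for \<open>w\<close> equal to
    \<open>x\<close> or \<open>y\<close> it separates the two.\<close>
  moreover have "openin (lower_topology r) {z. r w z}" "w \<in> {z. r w z}" for w
    using assms by (auto simp: openin_lower_topology dest: transpD reflpD)
  ultimately show "\<exists>U. openin (lower_topology r) U \<and> (x \<notin> U) = (y \<in> U)"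
    by (metis mem_Collect_eq)
qed

text \<open>If \<open>x\<close> and \<open>y\<close> had no common upper bound in \<open>A\<close>,
  the points of \<open>A\<close> not above \<open>x\<close> and those not above \<open>y\<close>
  would be two proper closed subsets covering \<open>A\<close>.\<close>

lemma irreducible_closedin_lower_topology_imp_directed:
  assumes r: "reflp r" "transp r" and A: "irreducible_closedin (lower_topology r) A"
  shows "directed_in (lower_topology r) A"
proof -
  have down: "x \<in> A" if "y \<in> A" "r x y" for x y
    using A that by (auto simp: irreducible_closedin_def closedin_lower_topology)
  have "\<exists>z\<in>A. r x z \<and> r y z" if "x \<in> A" "y \<in> A" for x y
  proof (rule ccontr)
    assume "\<not> ?thesis"
    then have "A = {z\<in>A. \<not> r x z} \<union> {z\<in>A. \<not> r y z}"
      by blast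
    moreover have "closedin (lower_topology r) {z\<in>A. \<not> r w z}" for w
      using down r(2) by (auto simp: closedin_lower_topology dest: transpD)
    ultimately have "A = {z\<in>A. \<not> r x z} \<or> A = {z\<in>A. \<not> r y z}"
      using A unfolding irreducible_closedin_def by blast
    then show False
      using that r(1) by (auto dest: reflpD)
  qed
  then show ?thesis
    using A by (simp add: directed_in_def irreducible_closedin_def spec_le_lower_topology[OF r])
qed

text \<open>The chain is \<open>2, 3, 4, \<dots>\<close> in its usual order; \<open>0\<close> and \<open>1\<close> are the two incomparable upper bounds.\<close>

definition fork_le :: "nat \<Rightarrow> nat \<Rightarrow> bool" where
  "fork_le x y \<longleftrightarrow> x = y \<or> 2 \<le> x \<and> (y < 2 \<or> x \<le> y)"

lemma fork_le_order: "reflp fork_le" "transp fork_le" "antisymp fork_le"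
  by (auto simp: fork_le_def intro!: reflpI transpI antisympI)

lemmas spec_le_fork = spec_le_lower_topology[OF fork_le_order(1,2)]

text \<open>A prong in \<open>A\<close> is maximal, so directedness makes it the greatest element.
  Otherwise \<open>A\<close> lies in the chain: if finite it has a maximum, if infinite it is
  cofinal and so is the whole chain.\<close>

lemma fork_directed_lower_set_cases:
  assumes dir: "\<And>x y. x \<in> A \<Longrightarrow> y \<in> A \<Longrightarrow> \<exists>z\<in>A. fork_le x z \<and> fork_le y z"
    and down: "\<And>x y. y \<in> A \<Longrightarrow> fork_le x y \<Longrightarrow> x \<in> A" and "A \<noteq> {}"
  obtains m where "A = {x. fork_le x m}" | "A = {2..}"
proof -
  consider m where "m \<in> A" "m < 2" | "A \<subseteq> {2..}" "finite A" | "A \<subseteq> {2..}" "infinite A"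
    by fastforce
  then show thesis
  proof cases
    case 1
    then have "fork_le x m" if "x \<in> A" for x
      using dir[OF that \<open>m \<in> A\<close>] by (auto simp: fork_le_def)
    then have "A = {x. fork_le x m}"
      using down 1 by blast
    then show ?thesis by (rule that)
  next
    case 2
    define m where "m = Max A"
    have m: "m \<in> A" "x \<le> m" if "x \<in> A" for x
      using 2 that by (auto simp: m_def intro: Max_in)
    have "fork_le x m" if "x \<in> A" for x
      using that m 2(1) by (auto simp: fork_le_def)
    then have "A = {x. fork_le x m}"
      using down m(1) \<open>A \<noteq> {}\<close> by blast
    then show ?thesis by (rule that)
  next
    case 3
    have "x \<in> A" if x: "2 \<le> x" for x
    proof -
      obtain y where "y \<in> A" "x \<le> y"
        using 3 by (metis infinite_nat_iff_unbounded_le)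
      then show ?thesis
        using down x by (auto simp: fork_le_def)
    qed
    then have "A = {2..}"
      using 3 by auto
    then show ?thesis by (rule that)
  qed
qed

text \<open>Each irreducible closed set is directed and serves as its own \<open>D\<close>:
  principal ideals are cuts, and the chain is the set of common lower bounds of \<open>0\<close> and
  \<open>1\<close>.\<close>

lemma quasisober_fork: "quasisober_space (lower_topology fork_le)"
  unfolding quasisober_space_def
proof (intro conjI allI impI)
  let ?X = "lower_topology fork_le"
  show "t0_space ?X"
    by (intro t0_space_lower_topology fork_le_order)
  fix A assume A: "irreducible_closedin ?X A"
  have dir: "directed_in ?X A"
    by (intro irreducible_closedin_lower_topology_imp_directed fork_le_order A)
  have "\<exists>z\<in>A. fork_le x z \<and> fork_le y z" if "x \<in> A" "y \<in> A" for x y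
    using dir that by (auto simp: directed_in_def spec_le_fork)
  moreover have "x \<in> A" if "y \<in> A" "fork_le x y" for x y
    using A that by (auto simp: irreducible_closedin_def closedin_lower_topology)
  moreover have "A \<noteq> {}"
    using A by (simp add: irreducible_closedin_def)
  ultimately consider m where "A = {x. fork_le x m}" | "A = {2..}"
    using fork_directed_lower_set_cases by metis
  then have "A = cut_closure ?X A"
  proof cases
    case 1
    then show ?thesis
      using fork_le_order(1,2)
      by (auto simp: cut_closure_def lower_bounds_def upper_bounds_def spec_le_fork
          dest: reflpD transpD)
  next
    case 2
    have "upper_bounds ?X A = {0, 1}"
    proof -
      \<comment> \<open>The chain element \<open>u + 2\<close> is numerically larger than
        \<open>u\<close>, so it can lie below \<open>u\<close> only if \<open>u\<close> is a
        prong.\<close>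
      have "u < 2" if "\<forall>a\<ge>2. fork_le a u" for u
        using that[rule_format, of "u + 2"] by (simp add: fork_le_def)
      then show ?thesis
        unfolding 2 upper_bounds_def by (fastforce simp: spec_le_fork fork_le_def)
    qed
    then show ?thesis
      unfolding 2 by (auto simp: cut_closure_def lower_bounds_def spec_le_fork fork_le_def)
  qed
  with dir show "\<exists>D. directed_in ?X D \<and> A = cut_closure ?X D"
    by blast
qed

lemma closedin_fork_prong: "closedin (lower_topology fork_le) (- {0})"
  by (auto simp: closedin_lower_topology fork_le_def)

lemma not_cut_space_fork_prong: "\<not> cut_space (subtopology (lower_topology fork_le) (- {0}))"
proof
  let ?X = "lower_topology fork_le" and ?C = "- {0::nat}"
  let ?Y = "subtopology ?X ?C"
  assume cut: "cut_space ?Y"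
  \<comment> \<open>In the subspace the closure of \<open>{0}\<close> is empty, which accounts for
    the condition on \<open>y\<close>.\<close>
  have le: "spec_le ?Y x y \<longleftrightarrow> x \<noteq> 0 \<and> y \<noteq> 0 \<and> fork_le x y" for x y
    by (auto simp: spec_le_def closure_of_subtopology closure_of_lower_topology fork_le_order)
  have "directed_in ?Y {2..}"
    unfolding directed_in_def
  proof (intro conjI ballI)
    fix x y :: nat assume "x \<in> {2..}" "y \<in> {2..}"
    then show "\<exists>z\<in>{2..}. spec_le ?Y x z \<and> spec_le ?Y y z"
      by (intro bexI[of _ "max x y"]) (auto simp: le fork_le_def)
  qed auto
  moreover have "closedin ?Y {2..}"
    by (auto simp: closedin_closed_subtopology closedin_fork_prong
        closedin_lower_topology fork_le_def)
  ultimately have "{2..} = cut_closure ?Y {2..}"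
    using cut closure_of_closedin unfolding cut_space_def by metis
  \<comment> \<open>With \<open>0\<close> removed, only the prong \<open>1\<close> can bound the
    chain, so \<open>1\<close> enters the cut closure although the chain is closed.\<close>
  moreover have "upper_bounds ?Y {2..} \<subseteq> {1}"
  proof
    fix u assume "u \<in> upper_bounds ?Y {2..}"
    then have "spec_le ?Y (u + 2) u"
      by (simp add: upper_bounds_def)
    then show "u \<in> {1}"
      by (auto simp: le fork_le_def)
  qed
  then have "1 \<in> cut_closure ?Y {2..}"
    by (auto simp: cut_closure_def lower_bounds_def le fork_le_def)
  ultimately have "1 \<in> {2::nat..}"
    by blast
  then show False
    by simp
qed

theorem mainTheorem1:
  shows "(\<exists>(X :: nat topology) C. closedin X C \<and> quasisober_space X \<and>
            \<not> quasisober_space (subtopology X C)) \<and>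
         (\<exists>(X :: nat topology) C. closedin X C \<and> cut_space X \<and>
            \<not> cut_space (subtopology X C)) \<and>
         (\<exists>(X :: nat topology) C. closedin X C \<and> weakly_sober_space X \<and>
            \<not> weakly_sober_space (subtopology X C))"
  \<comment> \<open>One space and one subspace serve all three parts: the implications carry
    quasisobriety down on the whole space and, contraposed, the failure of the cut property up on
    the subspace.\<close>
  by (intro conjI exI[of _ "lower_topology fork_le"] exI[of _ "- {0}"] closedin_fork_prong)
    (use quasisober_fork not_cut_space_fork_prong quasisober_imp_weakly_sober
      weakly_sober_imp_cut_space in blast)+

end
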